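(* Let $\alpha\in[1,2)$, let $A\in\mathbb{R}^{2\times 2}$ have characteristic polynomial $f(\lambda)=\lambda^2+a_1\lambda+a_2$, and put $s=\cos^2\left(\frac{\alpha\pi}{2}\right)$. Then the fractional-order system $\mathrm{D}^{\alpha}x=Ax$ is asymptotically stable if and only if $$a_1>0,\qquad a_2\left(a_1^2-4a_2s\right)>0.$$
   Context: The system is $\mathrm{D}^{\alpha}x=Ax$ with state vector $x$, fractional order $\alpha\in[1,2)$ and real matrix $A$. Asymptotic stability is used through the known criterion of Matignon: the system is asymptotically stable if and only if every eigenvalue $\lambda_j\in\mathbb{C}$ of $A$ satisfies $|\arg(\lambda_j)|>\frac{\alpha\pi}{2}$, where $\arg$ is the principal argument in $(-\pi,\pi]$ (a zero eigenvalue is regarded as violating this condition). *)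

theory Defs
  imports Complex_Main "Jordan_Normal_Form.Char_Poly"
begin

(* Asymptotic stability of the fractional-order system D^\<alpha> x = A x, taken in the form of
   Matignon's criterion. The eigenvalues are those of the real matrix A over the complex
   numbers. Since Arg 0 = 0, the condition on 0 is redundant for \<alpha> \<ge> 0; it is
   spelled out because the argument of 0 is only a library convention. *)
definition frac_asymptotically_stable :: "real \<Rightarrow> real mat \<Rightarrow> bool" where
  "frac_asymptotically_stable \<alpha> A \<longleftrightarrow>
     (\<forall>z. eigenvalue (map_mat complex_of_real A) z \<longrightarrow>
        z \<noteq> 0 \<and> \<bar>Arg z\<bar> > \<alpha> * pi / 2)"

end

theory Submission
  imports Defs
begin

text \<open>Since cosine decreases on \<open>[0, \<pi>]\<close>, the sector condition \<open>\<bar>arg z\<bar> > \<theta>\<close> says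
  \<open>Re z < \<bar>z\<bar> cos \<theta>\<close>; for \<open>cos \<theta> \<le> 0\<close> this can be squared. A pair of real roots lies in
  the sector iff both roots are negative; a conjugate pair has real part \<open>-a\<^sub>1/2\<close> and squared
  modulus \<open>a\<^sub>2\<close>.\<close>

lemma sector_iff_square:
  assumes "pi / 2 \<le> \<theta>" "\<theta> < pi"
  shows "z \<noteq> 0 \<and> \<bar>Arg z\<bar> > \<theta> \<longleftrightarrow> Re z < 0 \<and> (cos \<theta>)\<^sup>2 * (cmod z)\<^sup>2 < (Re z)\<^sup>2"
proof (cases "z = 0")
  case False
  have Re: "Re z = cmod z * cos \<bar>Arg z\<bar>"
    using arg_cong[OF rcis_cmod_Arg[of z], of Re] by simp
  have "\<bar>Arg z\<bar> \<le> pi"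
    using Arg_bounded[of z] by auto
  then have "\<theta> < \<bar>Arg z\<bar> \<longleftrightarrow> cos \<bar>Arg z\<bar> < cos \<theta>"
    using assms by (intro cos_mono_less_eq[symmetric]) auto
  also have "\<dots> \<longleftrightarrow> Re z < cmod z * cos \<theta>"
    using False by (simp add: Re)
  \<comment> \<open>Changing signs makes the left side nonnegative, so the strict inequality forces
    \<open>Re z < 0\<close> by itself and both sides can be squared without loss.\<close>
  also have "\<dots> \<longleftrightarrow> cmod z * - cos \<theta> < - Re z"
    by auto
  also have "\<dots> \<longleftrightarrow> Re z < 0 \<and> (cmod z * - cos \<theta>)\<^sup>2 < (- Re z)\<^sup>2"
  proof -
    have "0 \<le> - cos \<theta>"
      using cos_monotone_0_pi_le[of "pi / 2" \<theta>] assms by simp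
    then have "0 \<le> cmod z * - cos \<theta>"
      by (intro mult_nonneg_nonneg) auto
    then show ?thesis
      by (smt (verit) power_strict_mono power_mono zero_less_numeral)
  qed
  finally show ?thesis
    using False by (simp add: power_mult_distrib mult.commute)
qed simp

text \<open>Explicit roots turn a condition on all eigenvalues into a conjunction of two instances.
  The split on the discriminant keeps every square root real and nonnegative.\<close>

lemma complex_monic_quadratic_roots:
  fixes b c :: real and z :: complex
  shows "z\<^sup>2 + of_real b * z + of_real c = 0 \<longleftrightarrow>
    (if b\<^sup>2 - 4 * c \<ge> 0
     then z = of_real ((- b + sqrt (b\<^sup>2 - 4 * c)) / 2) \<or> z = of_real ((- b - sqrt (b\<^sup>2 - 4 * c)) / 2)
     else z = Complex (- b / 2) (sqrt (4 * c - b\<^sup>2) / 2) \<or>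
          z = Complex (- b / 2) (- sqrt (4 * c - b\<^sup>2) / 2))"
proof (cases "b\<^sup>2 - 4 * c \<ge> 0")
  case True
  define d where "d = sqrt (b\<^sup>2 - 4 * c)"
  \<comment> \<open>Eliminating \<open>c\<close> in favour of \<open>d\<close> makes the
    factorization a polynomial identity, free of square roots.\<close>
  have c: "c = (b\<^sup>2 - d\<^sup>2) / 4"
    using True by (simp add: d_def)
  have "z\<^sup>2 + of_real b * z + of_real c
      = (z - of_real ((- b + d) / 2)) * (z - of_real ((- b - d) / 2))"
    unfolding c by (simp add: field_simps power2_eq_square)
  then show ?thesis
    using True by (simp add: d_def)
next
  case False
  define d where "d = sqrt (4 * c - b\<^sup>2)"
  have c: "c = (b\<^sup>2 + d\<^sup>2) / 4"
    using False by (simp add: d_def)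
  have "z\<^sup>2 + of_real b * z + of_real c
      = (z - Complex (- b / 2) (d / 2)) * (z - Complex (- b / 2) (- d / 2))"
    unfolding c by (simp add: complex_eq_iff field_simps power2_eq_square)
  then show ?thesis
    using False by (simp add: d_def)
qed

theorem corollary1:
  fixes \<alpha> a\<^sub>1 a\<^sub>2 s :: real and A :: "real mat"
  assumes "1 \<le> \<alpha>" and "\<alpha> < 2"
    and "A \<in> carrier_mat 2 2"
    and "char_poly A = [:a\<^sub>2, a\<^sub>1, 1:]"
    and "s = (cos (\<alpha> * pi / 2))\<^sup>2"
  shows "frac_asymptotically_stable \<alpha> A \<longleftrightarrow>
           a\<^sub>1 > 0 \<and> a\<^sub>2 * (a\<^sub>1\<^sup>2 - 4 * a\<^sub>2 * s) > 0"
proof -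
  define \<theta> where "\<theta> = \<alpha> * pi / 2"
  have \<theta>: "pi / 2 \<le> \<theta>" "\<theta> < pi"
    using assms(1,2) by (auto simp: \<theta>_def)
  have s: "s = (cos \<theta>)\<^sup>2"
    using assms(5) by (simp add: \<theta>_def)
  \<comment> \<open>As \<theta> stays strictly below \<pi>, \<open>s\<close> is strictly below 1. On
    the real axis, where the squared modulus is the squared real part, this leaves only the sign
    condition.\<close>
  have "sin \<theta> > 0"
    using \<theta> pi_gt_zero by (intro sin_gt_zero) linarith+
  then have s_bounds: "0 \<le> s" "s < 1"
    by (simp add: s, simp add: s cos_squared_eq)
  let ?in_sector = "\<lambda>z. Re z < 0 \<and> s * (cmod z)\<^sup>2 < (Re z)\<^sup>2"
  have "eigenvalue (map_mat complex_of_real A) z \<longleftrightarrow> z\<^sup>2 + of_real a\<^sub>1 * z + of_real a\<^sub>2 = 0" for z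
  proof -
    have "eigenvalue (map_mat complex_of_real A) z \<longleftrightarrow> poly (char_poly (map_mat complex_of_real A)) z = 0"
      using assms(3) by (intro eigenvalue_root_char_poly) auto
    also have "char_poly (map_mat complex_of_real A) = [:of_real a\<^sub>2, of_real a\<^sub>1, 1:]"
      using of_real_hom.char_poly_hom[OF assms(3), where ?'a = complex] assms(4) by simp
    finally show ?thesis
      by (simp add: algebra_simps power2_eq_square)
  qed
  then have stable: "frac_asymptotically_stable \<alpha> A \<longleftrightarrow>
      (\<forall>z. z\<^sup>2 + of_real a\<^sub>1 * z + of_real a\<^sub>2 = 0 \<longrightarrow> ?in_sector z)"
    using sector_iff_square[OF \<theta>] by (simp add: frac_asymptotically_stable_def \<theta>_def s)
  show ?thesis
  proof (cases "a\<^sub>1\<^sup>2 - 4 * a\<^sub>2 \<ge> 0")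
    case True
    define d where "d = sqrt (a\<^sub>1\<^sup>2 - 4 * a\<^sub>2)"
    have d: "d \<ge> 0" "d\<^sup>2 = a\<^sub>1\<^sup>2 - 4 * a\<^sub>2"
      using True by (auto simp: d_def)
    have real: "?in_sector (of_real x) \<longleftrightarrow> x < 0" for x
      using s_bounds by auto
    have "frac_asymptotically_stable \<alpha> A \<longleftrightarrow>
        ?in_sector (of_real ((- a\<^sub>1 + d) / 2)) \<and> ?in_sector (of_real ((- a\<^sub>1 - d) / 2))"
      unfolding stable complex_monic_quadratic_roots d_def if_P[OF True] by blast
    also have "\<dots> \<longleftrightarrow> (- a\<^sub>1 + d) / 2 < 0 \<and> (- a\<^sub>1 - d) / 2 < 0"
      unfolding real ..
    also have "\<dots> \<longleftrightarrow> d < a\<^sub>1"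
      using d(1) by auto
    \<comment> \<open>Since \<open>d\<close> is nonnegative, \<open>d < a\<^sub>1\<close> makes
      \<open>a\<^sub>1\<close> positive, and squaring is then reversible.\<close>
    also have "\<dots> \<longleftrightarrow> a\<^sub>1 > 0 \<and> d\<^sup>2 < a\<^sub>1\<^sup>2"
      using d(1) by (smt (verit) power_strict_mono power_mono zero_less_numeral)
    also have "\<dots> \<longleftrightarrow> a\<^sub>1 > 0 \<and> a\<^sub>2 > 0"
      using d(2) by simp
    also have "\<dots> \<longleftrightarrow> a\<^sub>1 > 0 \<and> a\<^sub>2 * (a\<^sub>1\<^sup>2 - 4 * a\<^sub>2 * s) > 0"
    proof -
      \<comment> \<open>With real roots the second factor is automatically positive, so the product
        has the sign of \<open>a\<^sub>2\<close>: if \<open>a\<^sub>2 > 0\<close>, then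
        \<open>4 * a\<^sub>2 * s < 4 * a\<^sub>2 \<le> a\<^sub>1\<^sup>2\<close>; otherwise a
        nonpositive number is subtracted from a positive square.\<close>
      have "a\<^sub>1\<^sup>2 - 4 * a\<^sub>2 * s > 0" if "a\<^sub>1 > 0"
      proof (cases "a\<^sub>2 > 0")
        case a2: True
        then have "a\<^sub>2 * s < a\<^sub>2"
          using s_bounds by simp
        then show ?thesis
          using True by linarith
      next
        case False
        then have "a\<^sub>2 * s \<le> 0"
          using s_bounds by (simp add: mult_nonpos_nonneg)
        then show ?thesis
          using that zero_less_power[of a\<^sub>1 2] by linarith
      qed
      then show ?thesis
        by (auto simp: zero_less_mult_iff)
    qed
    finally show ?thesis .
  next
    case False
    define d where "d = sqrt (4 * a\<^sub>2 - a\<^sub>1\<^sup>2)"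
    have d: "d\<^sup>2 = 4 * a\<^sub>2 - a\<^sub>1\<^sup>2"
      using False by (auto simp: d_def)
    have a2: "a\<^sub>2 > 0"
      using False zero_le_power2[of a\<^sub>1] by linarith
    \<comment> \<open>Only the square of the imaginary part matters, so a single statement serves
      both conjugate roots.\<close>
    have norm: "(cmod (Complex (- a\<^sub>1 / 2) y))\<^sup>2 = a\<^sub>2" if "y\<^sup>2 = (d / 2)\<^sup>2" for y
      using that by (simp add: cmod_power2 power_divide d)
    have conj: "?in_sector (Complex (- a\<^sub>1 / 2) y) \<longleftrightarrow> a\<^sub>1 > 0 \<and> a\<^sub>1\<^sup>2 - 4 * a\<^sub>2 * s > 0"
      if "y\<^sup>2 = (d / 2)\<^sup>2" for y
      unfolding norm[OF that] by (simp add: power_divide) argo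
    have "frac_asymptotically_stable \<alpha> A \<longleftrightarrow>
        ?in_sector (Complex (- a\<^sub>1 / 2) (d / 2)) \<and> ?in_sector (Complex (- a\<^sub>1 / 2) (- d / 2))"
      unfolding stable complex_monic_quadratic_roots d_def if_not_P[OF False] by blast
    also have "\<dots> \<longleftrightarrow> a\<^sub>1 > 0 \<and> a\<^sub>1\<^sup>2 - 4 * a\<^sub>2 * s > 0"
      using conj[of "d / 2"] conj[of "- d / 2"] by simp
    also have "\<dots> \<longleftrightarrow> a\<^sub>1 > 0 \<and> a\<^sub>2 * (a\<^sub>1\<^sup>2 - 4 * a\<^sub>2 * s) > 0"
      using a2 by (simp add: zero_less_mult_iff)
    finally show ?thesis .
  qed
qed

end
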